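(* Let $(F,\le)$ be an ordered field and $n$ a positive integer. For every two elements $v_n(A),v_n(B)$ of $\Gamma_n\cup\{\infty\}=M_{\ast,n}(F)/\!\sim_n$ (with $A,B\in M_{\ast,n}(F)$), their greatest lower bound and their least upper bound exist and are given by $$v_n(A)\wedge_n v_n(B)=v_n\left(\begin{bmatrix}A\\ B\end{bmatrix}\right)\quad\text{and}\quad v_n(A)\vee_n v_n(B)=v_n\left(\begin{bmatrix}A(A^TA+B^TB)^+B^TB\\ B(A^TA+B^TB)^+A^TA\end{bmatrix}\right).$$
   Context: $M_{\ast,n}(F)=\bigcup_{m\ge 1}M_{m,n}(F)$ is the set of all matrices over $F$ with $n$ columns. For symmetric $S,T\in M_n(F)$ write $S\le_n T$ iff $T-S$ is positive semidefinite, i.e. $v^T(T-S)v\ge 0$ for all $v\in F^n$. For $A,B\in M_{\ast,n}(F)$ (possibly with different numbers of rows) write $A\succeq_n B$ iff there is $r\in\mathbb N$ with $A^TA\le_n rB^TB$, and $A\sim_n B$ iff $A\succeq_n B$ and $B\succeq_n A$; $v_n(A)$ denotes the $\sim_n$-class of $A$. The set of classes is partially ordered by $v_n(A)\succeq v_n(B)$ iff $A\succeq_n B$ (read as "$v_n(A)$ is greater than or equal to $v_n(B)$"). Here $\infty$ is the class of zero, $\Gamma_n\cup\{\infty\}$ is by definition $M_n(F)/\!\sim_n$, and it is identified with $M_{\ast,n}(F)/\!\sim_n$ via the map induced by the inclusion $M_n(F)\subseteq M_{\ast,n}(F)$, which is an isomorphism of partially ordered sets. For a symmetric $C\in M_n(F)$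 one has $F^n=\operatorname{im}C\oplus\ker C$, and the Moore–Penrose inverse is $C^+=(C|_{\operatorname{im}C})^{-1}\oplus 0|_{\ker C}$. *)

theory Defs
  imports "Jordan_Normal_Form.Matrix_Kernel" "HOL-Algebra.Lattice"
begin

text \<open>The set $M_{\ast,n}(F)$ of all matrices with $n$ columns and at least one row.\<close>

definition matrices_with_cols :: "nat \<Rightarrow> 'a mat set" where
  "matrices_with_cols n = (\<Union>m\<in>{1..}. carrier_mat m n)"

text \<open>The relation $S \le_n T$, meant for symmetric $n \times n$ matrices.\<close>

definition loewner_le :: "nat \<Rightarrow> 'a::linordered_field mat \<Rightarrow> 'a mat \<Rightarrow> bool" where
  "loewner_le n S T \<longleftrightarrow> (\<forall>v\<in>carrier_vec n. v \<bullet> ((T - S) *\<^sub>v v) \<ge> 0)"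

text \<open>The relation $A \succeq_n B$; here $A$ and $B$ may have different numbers of rows.\<close>

definition dominates :: "nat \<Rightarrow> 'a::linordered_field mat \<Rightarrow> 'a mat \<Rightarrow> bool" where
  "dominates n A B \<longleftrightarrow>
     (\<exists>r::nat. loewner_le n (transpose_mat A * A) (of_nat r \<cdot>\<^sub>m (transpose_mat B * B)))"

definition sim_rel :: "nat \<Rightarrow> ('a::linordered_field mat \<times> 'a mat) set" where
  "sim_rel n = {(A, B). A \<in> matrices_with_cols n \<and> B \<in> matrices_with_cols n \<and>
                        dominates n A B \<and> dominates n B A}"

definition val_class :: "nat \<Rightarrow> 'a::linordered_field mat \<Rightarrow> 'a mat set" where
  "val_class n A = sim_rel n `` {A}"

text \<open>
  The poset $\Gamma_n \cup \{\infty\}$. The field \<open>le a b\<close> reads ``$b$ is greater than or equal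
  to $a$'', that is $b \succeq a$, so that the class of the zero matrix is the top element.
  The order is given on representatives; see \<open>val_class_le_iff\<close> for its well-definedness.
\<close>

definition val_poset :: "nat \<Rightarrow> 'a::linordered_field mat set gorder" where
  "val_poset n =
     \<lparr> carrier = matrices_with_cols n // sim_rel n,
       eq = (=),
       le = (\<lambda>a b. \<exists>A\<in>a. \<exists>B\<in>b. dominates n B A) \<rparr>"

text \<open>
  The Moore--Penrose inverse of a symmetric matrix $C$: since $F^n = \mathrm{im}\, C \oplus \ker C$,
  it is the unique matrix that acts as $(C|_{\mathrm{im}\, C})^{-1}$ on $\mathrm{im}\, C$ and
  as zero on $\ker C$. For non-symmetric $C$ the value is of no relevance.
\<close>

definition mat_im :: "'a::comm_ring_1 mat \<Rightarrow> 'a vec set" where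
  "mat_im C = (\<lambda>x. C *\<^sub>v x) ` carrier_vec (dim_col C)"

definition moore_penrose :: "'a::linordered_field mat \<Rightarrow> 'a mat" where
  "moore_penrose C = (THE P. P \<in> carrier_mat (dim_row C) (dim_row C) \<and>
     (\<forall>y\<in>mat_im C. P *\<^sub>v y = the_inv_into (mat_im C) (\<lambda>x. C *\<^sub>v x) y) \<and>
     (\<forall>z\<in>mat_kernel C. P *\<^sub>v z = 0\<^sub>v (dim_row C)))"

lemma loewner_le_iff:
  fixes S T :: "'a::linordered_field mat"
  assumes "S \<in> carrier_mat n n" "T \<in> carrier_mat n n"
  shows "loewner_le n S T \<longleftrightarrow> (\<forall>v\<in>carrier_vec n. v \<bullet> (S *\<^sub>v v) \<le> v \<bullet> (T *\<^sub>v v))"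
proof -
  have "v \<bullet> ((T - S) *\<^sub>v v) = v \<bullet> (T *\<^sub>v v) - v \<bullet> (S *\<^sub>v v)" if "v \<in> carrier_vec n" for v
    using assms that
    by (subst minus_mult_distrib_mat_vec[of _ n n])
       (auto intro!: scalar_prod_minus_distrib[of _ n] simp: mult_mat_vec_carrier)
  then show ?thesis unfolding loewner_le_def by auto
qed

lemma dominates_iff:
  fixes A B :: "'a::linordered_field mat"
  assumes "A \<in> matrices_with_cols n" "B \<in> matrices_with_cols n"
  shows "dominates n A B \<longleftrightarrow> (\<exists>r::nat. \<forall>v\<in>carrier_vec n.
           v \<bullet> ((transpose_mat A * A) *\<^sub>v v) \<le> of_nat r * (v \<bullet> ((transpose_mat B * B) *\<^sub>v v)))"
proof -
  have A: "transpose_mat A * A \<in> carrier_mat n n" and B: "transpose_mat B * B \<in> carrier_mat n n"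
    using assms by (auto simp: matrices_with_cols_def)
  have "v \<bullet> ((c \<cdot>\<^sub>m (transpose_mat B * B)) *\<^sub>v v) = c * (v \<bullet> ((transpose_mat B * B) *\<^sub>v v))"
    if "v \<in> carrier_vec n" for v and c :: 'a
  proof -
    have "(c \<cdot>\<^sub>m (transpose_mat B * B)) *\<^sub>v v = c \<cdot>\<^sub>v ((transpose_mat B * B) *\<^sub>v v)"
      using B that by (intro eq_vecI) auto
    then show ?thesis using B that by (metis mult_mat_vec_carrier scalar_prod_smult_distrib)
  qed
  then show ?thesis unfolding dominates_def
    using loewner_le_iff[OF A smult_carrier_mat[OF B]] by auto
qed

lemma dominates_refl:
  assumes "A \<in> matrices_with_cols n"
  shows "dominates n A A"
  unfolding dominates_iff[OF assms assms] by (rule exI[of _ 1]) auto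

lemma dominates_trans:
  fixes A B C :: "'a::linordered_field mat"
  assumes ABC: "A \<in> matrices_with_cols n" "B \<in> matrices_with_cols n" "C \<in> matrices_with_cols n"
    and "dominates n A B" "dominates n B C"
  shows "dominates n A C"
proof -
  let ?q = "\<lambda>A v::'a vec. v \<bullet> ((transpose_mat A * A) *\<^sub>v v)"
  obtain r s :: nat where r: "\<forall>v\<in>carrier_vec n. ?q A v \<le> of_nat r * ?q B v"
    and s: "\<forall>v\<in>carrier_vec n. ?q B v \<le> of_nat s * ?q C v"
    using assms dominates_iff by metis
  have "?q A v \<le> of_nat (r * s) * ?q C v" if "v \<in> carrier_vec n" for v
  proof -
    have "?q A v \<le> of_nat r * ?q B v" using r that by blast
    also have "\<dots> \<le> of_nat r * (of_nat s * ?q C v)" using s that by (intro mult_left_mono) auto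
    finally show ?thesis by (simp add: mult.assoc)
  qed
  then show ?thesis using dominates_iff ABC by metis
qed

lemma equiv_sim_rel: "equiv (matrices_with_cols n) (sim_rel n)"
  by (rule equivI)
     (auto simp: sim_rel_def refl_on_def sym_def trans_def intro: dominates_refl dominates_trans)

lemma val_class_le_iff:
  assumes "A \<in> matrices_with_cols n" "B \<in> matrices_with_cols n"
  shows "val_class n A \<sqsubseteq>\<^bsub>val_poset n\<^esub> val_class n B \<longleftrightarrow> dominates n B A"
proof
  assume "val_class n A \<sqsubseteq>\<^bsub>val_poset n\<^esub> val_class n B"
  then obtain A' B' where "(A, A') \<in> sim_rel n" "(B, B') \<in> sim_rel n" "dominates n B' A'"
    unfolding val_poset_def val_class_def by auto
  then show "dominates n B A" unfolding sim_rel_def by (auto intro: dominates_trans)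
next
  assume "dominates n B A"
  then show "val_class n A \<sqsubseteq>\<^bsub>val_poset n\<^esub> val_class n B"
    using assms equiv_class_self[OF equiv_sim_rel] unfolding val_poset_def val_class_def by auto
qed

lemma val_class_eq_iff:
  assumes "A \<in> matrices_with_cols n" "B \<in> matrices_with_cols n"
  shows "val_class n A = val_class n B \<longleftrightarrow> dominates n A B \<and> dominates n B A"
  using eq_equiv_class_iff[OF equiv_sim_rel assms] assms
  unfolding val_class_def by (auto simp: sim_rel_def)

lemma carrier_val_poset: "carrier (val_poset n) = val_class n ` matrices_with_cols n"
  unfolding val_poset_def val_class_def quotient_def by auto

lemma partial_order_val_poset: "partial_order (val_poset n)"
proof -
  have eq: "eq (val_poset n) = (=)" by (simp add: val_poset_def)
  show ?thesis
    by unfold_locales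
       (auto simp: eq carrier_val_poset val_class_le_iff
             intro: dominates_refl dominates_trans val_class_eq_iff[THEN iffD2]
             del: equalityI)
qed

end

theory Submission
  imports Defs
begin

text \<open>
  Write $|x|^2$ for $x \bullet x$. Since $v^T A^T A v = |Av|^2$, the relation $A \succeq_n B$ says
  that $|Av|^2 \le r |Bv|^2$ for all $v$ and some natural number $r$; everything takes place
  with these quadratic forms.

  For the meet this suffices: the form of the stacked matrix is $|Av|^2 + |Bv|^2$, and bounds on
  the two summands add up.

  For the join, put $S = A^T A$, $T = B^T B$, $C = S + T$ and split a vector $v$ as
  $y = C^+ T v$, $z = C^+ S v$. The form of the claimed join at $v$ is $|Ay|^2 + |Bz|^2$.
  This is the parallel sum of the two forms, that is, the least cost $|Ay|^2 + |Bz|^2$ over all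
  decompositions of $v$ into $y$ and $z$ (up to $\ker C$, which both forms ignore). Two properties
  of the splitting (\<open>parallel_sum_splitting\<close>) carry the proof. First, $Sy = Tz$, which is
  the stationarity condition of that minimization problem; it yields that the cost is at most
  $|Av|^2$ and at most $|Bv|^2$, the costs of the two trivial decompositions
  (\<open>split_sq_length_le\<close>). So the claimed matrix gives an upper bound. Second,
  $y + z$ differs from $v$ only by an element of $\ker C$. Hence a matrix $D$ whose form is
  bounded by multiples of both forms satisfies
  $|Dv|^2 = |Dy + Dz|^2 \le 2|Dy|^2 + 2|Dz|^2$, and the right-hand side is at most a multiple of
  $|Ay|^2 + |Bz|^2$ (\<open>sq_length_le_if_splitting\<close>). So the upper bound is the least one.

  Elements of an ordered field need not have square roots, but sums of squares are still nonnegative and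
  vanish only trivially. This is all that the existence of orthogonal projections needs, and from
  it follow $F^n = \mathrm{im}\, C \oplus \ker C$ for symmetric $C$ and the existence and
  uniqueness of $C^+$.
\<close>

section \<open>Positivity and orthogonal projection over an ordered field\<close>

lemma vec_eq_if_minus_eq_0:
  fixes u w :: "'a::ab_group_add vec"
  assumes "u - w = 0\<^sub>v n" "u \<in> carrier_vec n" "w \<in> carrier_vec n"
  shows "u = w"
proof (rule eq_vecI)
  show "u $ i = w $ i" if "i < dim_vec w" for i
    using arg_cong[OF assms(1), of "\<lambda>x. x $ i"] assms(2,3) that by simp
qed (use assms in auto)

lemma vec_add_cancel_commuted:
  fixes u v w :: "'a::ab_group_add vec"
  assumes eq: "u + v = v + w"
    and "u \<in> carrier_vec n" "v \<in> carrier_vec n" "w \<in> carrier_vec n"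
  shows "u = w"
proof (rule eq_vecI)
  show "u $ i = w $ i" if "i < dim_vec w" for i
    using arg_cong[OF eq, of "\<lambda>x. x $ i"] assms(2-4) that by simp
qed (use assms in auto)

lemma scalar_prod_self_nonneg: "0 \<le> v \<bullet> (v :: 'a::linordered_field vec)"
  unfolding scalar_prod_def by (rule sum_nonneg) simp

lemma scalar_prod_self_eq_0D:
  fixes v :: "'a::linordered_field vec"
  assumes "v \<bullet> v = 0" "v \<in> carrier_vec n"
  shows "v = 0\<^sub>v n"
proof (rule eq_vecI)
  have "\<forall>i\<in>{0..<dim_vec v}. v $ i * v $ i = 0"
    using assms(1) unfolding scalar_prod_def
    by (subst (asm) sum_nonneg_eq_0_iff) auto
  then show "v $ i = 0\<^sub>v n $ i" if "i < dim_vec (0\<^sub>v n)" for i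
    using that assms(2) by auto
qed (use assms(2) in auto)

lemma scalar_prod_sq_add_le:
  fixes v w :: "'a::linordered_field vec"
  assumes v: "v \<in> carrier_vec n" and w: "w \<in> carrier_vec n"
  shows "(v + w) \<bullet> (v + w) \<le> 2 * (v \<bullet> v) + 2 * (w \<bullet> w)"
proof -
  have "0 \<le> (v - w) \<bullet> (v - w)"
    by (rule scalar_prod_self_nonneg)
  moreover have "(v - w) \<bullet> (v - w) + (v + w) \<bullet> (v + w) = 2 * (v \<bullet> v) + 2 * (w \<bullet> w)"
    using v w by (simp add: add_scalar_prod_distrib[of _ n] scalar_prod_add_distrib[of _ n]
      minus_scalar_prod_distrib[of _ n] scalar_prod_minus_distrib[of _ n])
  ultimately show ?thesis by linarith
qed

text \<open>
  Gram--Schmidt without normalization. The last conjunct replaces the statement that $p$ lies in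
  the span of \<open>ws\<close>: it says that $p$ is orthogonal to everything that is orthogonal to
  \<open>ws\<close>, which is what the induction uses of membership in the span. The set $W$ is any
  subspace that contains \<open>ws\<close>; it makes the membership of $p$ in the column space of a
  matrix available later.
\<close>

lemma exists_orthogonal_projection:
  fixes W :: "'a::linordered_field vec set"
  assumes W: "W \<subseteq> carrier_vec n" "0\<^sub>v n \<in> W"
    and add: "\<And>x y. x \<in> W \<Longrightarrow> y \<in> W \<Longrightarrow> x + y \<in> W"
    and smult: "\<And>c x. x \<in> W \<Longrightarrow> c \<cdot>\<^sub>v x \<in> W"
    and "set ws \<subseteq> W" and "v \<in> carrier_vec n"
  shows "\<exists>p\<in>W. (\<forall>w\<in>set ws. (v - p) \<bullet> w = 0) \<and>
           (\<forall>u\<in>carrier_vec n. (\<forall>w\<in>set ws. u \<bullet> w = 0) \<longrightarrow> u \<bullet> p = 0)"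
  using assms(5,6)
proof (induction ws arbitrary: v)
  case Nil
  then show ?case using W by (intro bexI[of _ "0\<^sub>v n"]) auto
next
  case (Cons a ws)
  have aW: "a \<in> W" and a: "a \<in> carrier_vec n" using Cons.prems W by auto
  obtain p where p: "p \<in> W" "\<forall>w\<in>set ws. (v - p) \<bullet> w = 0"
      "\<And>u. u \<in> carrier_vec n \<Longrightarrow> \<forall>w\<in>set ws. u \<bullet> w = 0 \<Longrightarrow> u \<bullet> p = 0"
    using Cons.IH[of v] Cons.prems by auto
  obtain q where q: "q \<in> W" "\<forall>w\<in>set ws. (a - q) \<bullet> w = 0"
      "\<And>u. u \<in> carrier_vec n \<Longrightarrow> \<forall>w\<in>set ws. u \<bullet> w = 0 \<Longrightarrow> u \<bullet> q = 0"
    using Cons.IH[of a] Cons.prems a by auto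
  have pc: "p \<in> carrier_vec n" and qc: "q \<in> carrier_vec n" and v: "v \<in> carrier_vec n"
    and wc: "\<And>w. w \<in> set ws \<Longrightarrow> w \<in> carrier_vec n"
    using p(1) q(1) W Cons.prems by auto
  define d where "d = a - q"
  define c where "c = ((v - p) \<bullet> d) / (d \<bullet> d)"
  have dc: "d \<in> carrier_vec n" using a qc by (simp add: d_def)
  have dW: "d \<in> W"
  proof -
    have "d = a + (-1) \<cdot>\<^sub>v q" using a qc by (auto simp: d_def)
    then show ?thesis using add smult aW q(1) by metis
  qed
  have a_eq: "a = d + q" using a qc by (auto simp: d_def)
  \<comment> \<open>If \<open>d = 0\<close>, then \<open>a\<close> adds nothing to the span, and division by zero makes \<open>c = 0\<close>, so that
    \<open>p\<close> stays as it is; the orthogonality condition holds in this case as well.\<close>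
  have cd: "c * (d \<bullet> d) = (v - p) \<bullet> d"
  proof (cases "d \<bullet> d = 0")
    case True
    then have "d = 0\<^sub>v n" using dc scalar_prod_self_eq_0D by blast
    then show ?thesis using v pc by simp
  qed (simp add: c_def)
  define p' where "p' = p + c \<cdot>\<^sub>v d"
  have p'W: "p' \<in> W" using add smult p(1) dW by (simp add: p'_def)
  have split: "(v - p') \<bullet> w = (v - p) \<bullet> w - c * (d \<bullet> w)" if "w \<in> carrier_vec n" for w
    using v pc dc that unfolding p'_def
    by (simp add: add_scalar_prod_distrib[of _ n] minus_scalar_prod_distrib[of _ n])
  have orth: "(v - p') \<bullet> w = 0" if "w \<in> set ws" for w
    using split[OF wc[OF that]] p(2) q(2) that by (simp add: d_def)
  have vp'c: "v - p' \<in> carrier_vec n" using v pc dc by (simp add: p'_def)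
  have "(v - p') \<bullet> a = (v - p') \<bullet> d + (v - p') \<bullet> q"
    unfolding a_eq using vp'c dc qc by (rule scalar_prod_add_distrib)
  also have "\<dots> = 0"
    using split[OF dc] cd q(3)[OF vp'c] orth by simp
  finally have "(v - p') \<bullet> a = 0" .
  moreover have "u \<bullet> p' = 0" if u: "u \<in> carrier_vec n" "\<forall>w\<in>set (a # ws). u \<bullet> w = 0" for u
  proof -
    have "u \<bullet> d = u \<bullet> a - u \<bullet> q"
      unfolding d_def using u(1) a qc by (rule scalar_prod_minus_distrib)
    then have "u \<bullet> d = 0" using q(3)[OF u(1)] u(2) by simp
    then show ?thesis using p(3)[OF u(1)] u pc dc
      by (simp add: p'_def scalar_prod_add_distrib[of _ n])
  qed
  ultimately show ?case using p'W orth by (intro bexI[of _ p']) auto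
qed

lemma mult_unit_vec:
  fixes M :: "'a::comm_ring_1 mat"
  assumes M: "M \<in> carrier_mat m n" and j: "j < n"
  shows "M *\<^sub>v unit_vec n j = col M j"
  using col_mult2[OF M one_carrier_mat j] right_mult_one_mat[OF M] j by simp

lemma mult_mat_vec_minus_eq_0_iff:
  fixes M :: "'a::comm_ring_1 mat"
  assumes M: "M \<in> carrier_mat m n" and u: "u \<in> carrier_vec n" and w: "w \<in> carrier_vec n"
  shows "M *\<^sub>v (u - w) = 0\<^sub>v m \<longleftrightarrow> M *\<^sub>v u = M *\<^sub>v w"
proof -
  have "M *\<^sub>v u \<in> carrier_vec m" "M *\<^sub>v w \<in> carrier_vec m" using M u w by auto
  then show ?thesis
    unfolding mult_minus_distrib_mat_vec[OF M u w]
    using vec_eq_if_minus_eq_0[of "M *\<^sub>v u" "M *\<^sub>v w" m] by auto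
qed

lemma mat_eqI_mult_vec:
  fixes M N :: "'a::comm_ring_1 mat"
  assumes M: "M \<in> carrier_mat m n" and N: "N \<in> carrier_mat m n"
    and eq: "\<And>v. v \<in> carrier_vec n \<Longrightarrow> M *\<^sub>v v = N *\<^sub>v v"
  shows "M = N"
proof (rule mat_col_eqI)
  fix j assume "j < dim_col N"
  then have j: "j < n" using N by simp
  show "col M j = col N j"
    using mult_unit_vec[OF M j] mult_unit_vec[OF N j] eq[of "unit_vec n j"] by simp
qed (use M N in auto)

text \<open>
  The least squares problem is solvable: column by column, $X$ solves $C x \approx e_j$, where
  $C x$ is the orthogonal projection of $e_j$ onto the column space.
\<close>

lemma exists_normal_equation_solution:
  fixes C :: "'a::linordered_field mat"
  assumes C: "C \<in> carrier_mat m n"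
  shows "\<exists>X\<in>carrier_mat n m. transpose_mat C * C * X = transpose_mat C"
proof -
  have Ct: "transpose_mat C \<in> carrier_mat n m" using C by simp
  have "\<exists>x\<in>carrier_vec n. transpose_mat C *\<^sub>v (C *\<^sub>v x) = transpose_mat C *\<^sub>v v"
    if v: "v \<in> carrier_vec m" for v
  proof -
    let ?W = "(\<lambda>x. C *\<^sub>v x) ` carrier_vec n"
    have cols: "set (cols C) \<subseteq> ?W"
    proof
      fix w assume "w \<in> set (cols C)"
      then obtain j where j: "j < n" "w = col C j"
        using C by (auto simp: cols_def)
      have "col C j = C *\<^sub>v unit_vec n j"
        using mult_unit_vec[OF C j(1)] by simp
      then show "w \<in> ?W" using j by auto
    qed
    have W: "?W \<subseteq> carrier_vec m" using C by auto
    have zero: "0\<^sub>v m \<in> ?W"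
    proof -
      have "C *\<^sub>v 0\<^sub>v n = 0\<^sub>v m" using C by (intro eq_vecI) auto
      then show ?thesis by (metis image_eqI zero_carrier_vec)
    qed
    have add: "x + y \<in> ?W" if "x \<in> ?W" "y \<in> ?W" for x y
      using that C by (auto simp: mult_add_distrib_mat_vec[symmetric])
    have smult: "c \<cdot>\<^sub>v x \<in> ?W" if "x \<in> ?W" for c x
      using that C by (auto simp: mult_mat_vec[symmetric])
    obtain p where p: "p \<in> ?W" "\<forall>w\<in>set (cols C). (v - p) \<bullet> w = 0"
      using exists_orthogonal_projection[OF W zero add smult cols v] by blast
    then obtain x where x: "x \<in> carrier_vec n" "p = C *\<^sub>v x" by auto
    have pc: "p \<in> carrier_vec m" using x C by simp
    have "transpose_mat C *\<^sub>v (v - p) = 0\<^sub>v n"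
    proof (rule eq_vecI)
      fix j assume "j < dim_vec (0\<^sub>v n :: 'a vec)"
      then have j: "j < n" by simp
      have "col C j \<in> set (cols C)" using j C by (auto simp: cols_def)
      then have "col C j \<bullet> (v - p) = 0"
        using p(2) comm_scalar_prod[of "v - p" m "col C j"] v pc C j by auto
      then show "(transpose_mat C *\<^sub>v (v - p)) $ j = 0\<^sub>v n $ j" using j C by simp
    qed (use C in auto)
    then have "transpose_mat C *\<^sub>v v = transpose_mat C *\<^sub>v p"
      using mult_mat_vec_minus_eq_0_iff[OF Ct v pc] by simp
    then show ?thesis using x by auto
  qed
  then obtain f where f: "\<And>v. v \<in> carrier_vec m \<Longrightarrow> f v \<in> carrier_vec n"
      "\<And>v. v \<in> carrier_vec m \<Longrightarrow> transpose_mat C *\<^sub>v (C *\<^sub>v f v) = transpose_mat C *\<^sub>v v"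
    by metis
  define X where "X = mat_of_cols n (map (\<lambda>j. f (unit_vec m j)) [0..<m])"
  have X: "X \<in> carrier_mat n m" by (simp add: X_def mat_of_cols_def)
  have "transpose_mat C * C * X = transpose_mat C"
  proof (rule mat_col_eqI)
    fix j assume "j < dim_col (transpose_mat C)"
    then have j: "j < m" using C by simp
    have "col X j = f (unit_vec m j)" using j f(1) by (simp add: X_def)
    then have "col (transpose_mat C * C * X) j = (transpose_mat C * C) *\<^sub>v f (unit_vec m j)"
      using col_mult2[of "transpose_mat C * C" n n X m j] C X j by simp
    also have "\<dots> = transpose_mat C *\<^sub>v unit_vec m j"
      using f[of "unit_vec m j"] C Ct by (simp add: assoc_mult_mat_vec[OF Ct C])
    also have "\<dots> = col (transpose_mat C) j"
      by (rule mult_unit_vec[OF Ct j])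
    finally show "col (transpose_mat C * C * X) j = col (transpose_mat C) j" .
  qed (use C X in auto)
  then show ?thesis using X by blast
qed

section \<open>The Moore--Penrose inverse of a symmetric matrix\<close>

text \<open>
  For symmetric $C$ the image meets the kernel trivially, since
  $|Cx|^2 = (C C x) \bullet x$.
\<close>

lemma symmetric_im_inter_kernel:
  fixes C :: "'a::linordered_field mat"
  assumes C: "C \<in> carrier_mat n n" and sym: "transpose_mat C = C"
    and x: "x \<in> carrier_vec n" and "C *\<^sub>v (C *\<^sub>v x) = 0\<^sub>v n"
  shows "C *\<^sub>v x = 0\<^sub>v n"
proof -
  have "(C *\<^sub>v x) \<bullet> (C *\<^sub>v x) = (C *\<^sub>v (C *\<^sub>v x)) \<bullet> x"
    using transpose_vec_mult_scalar[OF C x, of "C *\<^sub>v x"] C x sym by simp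
  then have "(C *\<^sub>v x) \<bullet> (C *\<^sub>v x) = 0" using assms by simp
  then show ?thesis using C x scalar_prod_self_eq_0D mult_mat_vec_carrier by blast
qed

text \<open>
  A solution $X$ of $C^2 X = C$ splits every vector as $v = C X v + (v - C X v)$ with the second
  part in $\ker C$. So $CX$ is the projection onto $\mathrm{im}\, C$ along $\ker C$, and $C X X$
  satisfies the defining conditions of $C^+$, which determine a matrix because image and kernel
  together span. The two equations are $C C^+ C = C$ and $C C C^+ = C$; the latter says that
  $v - C C^+ v$ lies in $\ker C$.
\<close>

lemma moore_penrose_symmetric:
  fixes C :: "'a::linordered_field mat"
  assumes C: "C \<in> carrier_mat n n" and sym: "transpose_mat C = C"
  shows "moore_penrose C \<in> carrier_mat n n"
    and "x \<in> carrier_vec n \<Longrightarrow> C *\<^sub>v (moore_penrose C *\<^sub>v (C *\<^sub>v x)) = C *\<^sub>v x"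
    and "x \<in> carrier_vec n \<Longrightarrow> C *\<^sub>v (C *\<^sub>v (moore_penrose C *\<^sub>v x)) = C *\<^sub>v x"
proof -
  obtain X where X: "X \<in> carrier_mat n n" and CCX: "C * C * X = C"
    using exists_normal_equation_solution[OF C] sym by auto
  have CCXv: "C *\<^sub>v (C *\<^sub>v (X *\<^sub>v v)) = C *\<^sub>v v" if "v \<in> carrier_vec n" for v
  proof -
    have "C *\<^sub>v v = (C * C * X) *\<^sub>v v" by (simp add: CCX)
    then show ?thesis using C X that by (simp add: assoc_mult_mat_vec[of _ n n _ n])
  qed
  note ker = symmetric_im_inter_kernel[OF C sym]
  have Cdiff: "C *\<^sub>v u = C *\<^sub>v w"
    if "u \<in> carrier_vec n" "w \<in> carrier_vec n" "C *\<^sub>v (C *\<^sub>v u) = C *\<^sub>v (C *\<^sub>v w)" for u w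
  proof -
    have e: "C *\<^sub>v (u - w) = C *\<^sub>v u - C *\<^sub>v w"
      using C that by (simp add: mult_minus_distrib_mat_vec)
    have "C *\<^sub>v (C *\<^sub>v (u - w)) = 0\<^sub>v n"
      unfolding e using C that by (simp add: mult_minus_distrib_mat_vec[of _ n n])
    then show ?thesis using ker[of "u - w"] that mult_mat_vec_minus_eq_0_iff[OF C] by simp
  qed
  have im: "mat_im C = (\<lambda>x. C *\<^sub>v x) ` carrier_vec n" using C by (simp add: mat_im_def)
  \<comment> \<open>This makes the inverse on the image meaningful: \<open>C (X x)\<close> is the preimage of \<open>C x\<close>
    within \<open>im C\<close>.\<close>
  have inj: "inj_on (\<lambda>x. C *\<^sub>v x) (mat_im C)"
    using Cdiff by (auto simp: im inj_on_def)
  have inv: "the_inv_into (mat_im C) (\<lambda>x. C *\<^sub>v x) (C *\<^sub>v x) = C *\<^sub>v (X *\<^sub>v x)"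
    if x: "x \<in> carrier_vec n" for x
    using the_inv_into_f_f[OF inj, of "C *\<^sub>v (X *\<^sub>v x)"] CCXv[OF x] X x by (auto simp: im)
  let ?good = "\<lambda>P. P \<in> carrier_mat (dim_row C) (dim_row C) \<and>
     (\<forall>y\<in>mat_im C. P *\<^sub>v y = the_inv_into (mat_im C) (\<lambda>x. C *\<^sub>v x) y) \<and>
     (\<forall>z\<in>mat_kernel C. P *\<^sub>v z = 0\<^sub>v (dim_row C))"
  let ?P = "C * X * X"
  have P: "?P \<in> carrier_mat n n" using C X by simp
  have Pv: "?P *\<^sub>v v = C *\<^sub>v (X *\<^sub>v (X *\<^sub>v v))" if "v \<in> carrier_vec n" for v
    using C X that by (simp add: assoc_mult_mat_vec[of _ n n _ n])
  have P_im: "?P *\<^sub>v (C *\<^sub>v x) = C *\<^sub>v (X *\<^sub>v x)" if x: "x \<in> carrier_vec n" for x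
  proof -
    have "C *\<^sub>v (X *\<^sub>v (C *\<^sub>v x)) = C *\<^sub>v x"
      by (rule Cdiff) (use C X x CCXv[of "C *\<^sub>v x"] in auto)
    then have "C *\<^sub>v (C *\<^sub>v (X *\<^sub>v (X *\<^sub>v (C *\<^sub>v x)))) = C *\<^sub>v (C *\<^sub>v (X *\<^sub>v x))"
      using CCXv[of "X *\<^sub>v (C *\<^sub>v x)"] CCXv[OF x] C X x by simp
    then have "C *\<^sub>v (X *\<^sub>v (X *\<^sub>v (C *\<^sub>v x))) = C *\<^sub>v (X *\<^sub>v x)"
      by (rule Cdiff[rotated 2]) (use C X x in auto)
    then show ?thesis using Pv[of "C *\<^sub>v x"] C x by simp
  qed
  have P_ker: "?P *\<^sub>v z = 0\<^sub>v n" if "z \<in> mat_kernel C" for z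
  proof -
    have z: "z \<in> carrier_vec n" "C *\<^sub>v z = 0\<^sub>v n" using mat_kernelD[OF C that] by auto
    have "C *\<^sub>v (X *\<^sub>v z) = 0\<^sub>v n" using ker[of "X *\<^sub>v z"] CCXv[OF z(1)] z X by auto
    then have "C *\<^sub>v (C *\<^sub>v (X *\<^sub>v (X *\<^sub>v z))) = 0\<^sub>v n" using CCXv[of "X *\<^sub>v z"] X z by simp
    then show ?thesis using ker[of "X *\<^sub>v (X *\<^sub>v z)"] X z Pv by simp
  qed
  have good: "?good ?P"
    using P P_im P_ker inv C by (auto simp: im)
  have unique: "Q = ?P" if Q: "?good Q" for Q
  proof (rule mat_eqI_mult_vec[of _ n n])
    show Qc: "Q \<in> carrier_mat n n" using Q C by auto
    show "?P \<in> carrier_mat n n" by (rule P)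
    fix v :: "'a vec" assume v: "v \<in> carrier_vec n"
    let ?y = "C *\<^sub>v (X *\<^sub>v v)" and ?z = "v - C *\<^sub>v (X *\<^sub>v v)"
    have y: "?y \<in> mat_im C" using X v by (auto simp: im)
    have z: "?z \<in> mat_kernel C"
      by (rule mat_kernelI[OF C]) (use C X v CCXv[OF v] in \<open>auto simp: mult_minus_distrib_mat_vec[of _ n n]\<close>)
    have split: "L *\<^sub>v v = L *\<^sub>v ?y + L *\<^sub>v ?z" if "L \<in> carrier_mat n n" for L
    proof -
      have "v = ?y + ?z" using C X v by auto
      then show ?thesis using mult_add_distrib_mat_vec[OF that, of ?y ?z] C X v by auto
    qed
    show "Q *\<^sub>v v = ?P *\<^sub>v v"
      unfolding split[OF Qc] split[OF P] using Q good y z by simp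
  qed
  have mp: "moore_penrose C = ?P"
    unfolding moore_penrose_def by (rule the_equality) (use good unique in blast)+
  show "moore_penrose C \<in> carrier_mat n n" using P mp by simp
  show "C *\<^sub>v (moore_penrose C *\<^sub>v (C *\<^sub>v x)) = C *\<^sub>v x" if "x \<in> carrier_vec n"
    using P_im[OF that] CCXv[OF that] by (simp add: mp)
  show "C *\<^sub>v (C *\<^sub>v (moore_penrose C *\<^sub>v x)) = C *\<^sub>v x" if "x \<in> carrier_vec n"
    using Pv[OF that] CCXv[OF that] CCXv[of "X *\<^sub>v x"] X that by (simp add: mp)
qed

section \<open>The preorder in terms of squared lengths\<close>

lemma transpose_gram:
  fixes A :: "'a::comm_ring_1 mat"
  assumes "A \<in> carrier_mat m n"
  shows "transpose_mat (transpose_mat A * A) = transpose_mat A * A"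
  using assms by (simp add: transpose_mult[of _ n m _ n])

lemma quadratic_form_gram:
  fixes A :: "'a::linordered_field mat"
  assumes "A \<in> carrier_mat m n" "v \<in> carrier_vec n"
  shows "v \<bullet> ((transpose_mat A * A) *\<^sub>v v) = (A *\<^sub>v v) \<bullet> (A *\<^sub>v v)"
proof -
  have "v \<bullet> ((transpose_mat A * A) *\<^sub>v v) = v \<bullet> (transpose_mat A *\<^sub>v (A *\<^sub>v v))"
    using assms by (simp add: assoc_mult_mat_vec[of _ n m _ n])
  also have "\<dots> = (transpose_mat A *\<^sub>v (A *\<^sub>v v)) \<bullet> v"
    using assms by (intro comm_scalar_prod[of _ n]) auto
  also have "\<dots> = (A *\<^sub>v v) \<bullet> (A *\<^sub>v v)"
    using assms by (intro transpose_vec_mult_scalar) auto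
  finally show ?thesis .
qed

lemma dominates_iff_sq_length:
  fixes A B :: "'a::linordered_field mat"
  assumes "A \<in> matrices_with_cols n" "B \<in> matrices_with_cols n"
  shows "dominates n A B \<longleftrightarrow> (\<exists>r::nat. \<forall>v\<in>carrier_vec n.
           (A *\<^sub>v v) \<bullet> (A *\<^sub>v v) \<le> of_nat r * ((B *\<^sub>v v) \<bullet> (B *\<^sub>v v)))"
proof -
  obtain a b where "A \<in> carrier_mat a n" "B \<in> carrier_mat b n"
    using assms by (auto simp: matrices_with_cols_def)
  then show ?thesis unfolding dominates_iff[OF assms] by (simp add: quadratic_form_gram del: assoc_mult_mat_vec)
qed

lemma append_rows_sq_length:
  fixes A B :: "'a::linordered_field mat"
  assumes "A \<in> carrier_mat a n" "B \<in> carrier_mat b n" "v \<in> carrier_vec n"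
  shows "((A @\<^sub>r B) *\<^sub>v v) \<bullet> ((A @\<^sub>r B) *\<^sub>v v) = (A *\<^sub>v v) \<bullet> (A *\<^sub>v v) + (B *\<^sub>v v) \<bullet> (B *\<^sub>v v)"
  using assms by (simp add: mat_mult_append scalar_prod_append[of _ a _ b])

lemma append_rows_matrices_with_cols:
  assumes "A \<in> matrices_with_cols n" "B \<in> matrices_with_cols n"
  shows "A @\<^sub>r B \<in> matrices_with_cols n"
proof -
  obtain a b where "A \<in> carrier_mat a n" "B \<in> carrier_mat b n" "a \<ge> 1"
    using assms by (auto simp: matrices_with_cols_def)
  then have "A @\<^sub>r B \<in> carrier_mat (a + b) n" "a + b \<ge> 1" by auto
  then show ?thesis unfolding matrices_with_cols_def by blast
qed

lemma is_glb_val_classI: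
  assumes "A \<in> matrices_with_cols n" "B \<in> matrices_with_cols n" "M \<in> matrices_with_cols n"
    and "dominates n A M" "dominates n B M"
    and "\<And>D. D \<in> matrices_with_cols n \<Longrightarrow> dominates n A D \<Longrightarrow> dominates n B D \<Longrightarrow> dominates n M D"
  shows "is_glb (val_poset n) (val_class n M) {val_class n A, val_class n B}"
proof -
  have "Lower (val_poset n) {val_class n A, val_class n B} =
      val_class n ` {D \<in> matrices_with_cols n. dominates n A D \<and> dominates n B D}"
    unfolding Lower_def carrier_val_poset using assms(1,2) by (auto simp: val_class_le_iff)
  then show ?thesis
    unfolding greatest_def carrier_val_poset using assms(3-6) by (auto simp: val_class_le_iff)
qed

lemma is_lub_val_classI:
  assumes "A \<in> matrices_with_cols n" "B \<in> matrices_with_cols n" "M \<in> matrices_with_cols n"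
    and "dominates n M A" "dominates n M B"
    and "\<And>D. D \<in> matrices_with_cols n \<Longrightarrow> dominates n D A \<Longrightarrow> dominates n D B \<Longrightarrow> dominates n D M"
  shows "is_lub (val_poset n) (val_class n M) {val_class n A, val_class n B}"
proof -
  have "Upper (val_poset n) {val_class n A, val_class n B} =
      val_class n ` {D \<in> matrices_with_cols n. dominates n D A \<and> dominates n D B}"
    unfolding Upper_def carrier_val_poset using assms(1,2) by (auto simp: val_class_le_iff)
  then show ?thesis
    unfolding least_def carrier_val_poset using assms(3-6) by (auto simp: val_class_le_iff)
qed

section \<open>Optimal splitting of a vector between two forms\<close>

text \<open>
  If $Cz = 0$ with $C = A^T A + B^T B$, then $0 = z \bullet C z = |Az|^2 + |Bz|^2$.
\<close>

lemma gram_sum_kernel: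
  fixes A B :: "'a::linordered_field mat"
  assumes A: "A \<in> carrier_mat a n" and B: "B \<in> carrier_mat b n" and z: "z \<in> carrier_vec n"
    and "(transpose_mat A * A + transpose_mat B * B) *\<^sub>v z = 0\<^sub>v n"
  shows "A *\<^sub>v z = 0\<^sub>v a" "B *\<^sub>v z = 0\<^sub>v b"
proof -
  let ?S = "transpose_mat A * A" and ?T = "transpose_mat B * B"
  have S: "?S \<in> carrier_mat n n" and T: "?T \<in> carrier_mat n n" using A B by auto
  have "z \<bullet> (?S *\<^sub>v z) + z \<bullet> (?T *\<^sub>v z) = z \<bullet> ((?S + ?T) *\<^sub>v z)"
    unfolding add_mult_distrib_mat_vec[OF S T z] using S T z
    by (intro scalar_prod_add_distrib[symmetric]) auto
  also have "\<dots> = 0" using assms by simp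
  finally have "(A *\<^sub>v z) \<bullet> (A *\<^sub>v z) + (B *\<^sub>v z) \<bullet> (B *\<^sub>v z) = 0"
    using quadratic_form_gram[OF A z] quadratic_form_gram[OF B z] by simp
  then have "(A *\<^sub>v z) \<bullet> (A *\<^sub>v z) = 0 \<and> (B *\<^sub>v z) \<bullet> (B *\<^sub>v z) = 0"
    using scalar_prod_self_nonneg[of "A *\<^sub>v z"] scalar_prod_self_nonneg[of "B *\<^sub>v z"] by linarith
  then show "A *\<^sub>v z = 0\<^sub>v a" "B *\<^sub>v z = 0\<^sub>v b"
    using A B z scalar_prod_self_eq_0D mult_mat_vec_carrier by blast+
qed

text \<open>
  In terms of $C = S + T$ and the projection $C C^+$: the sum $y + z = C^+ C v$ agrees with $v$
  modulo $\ker C$, which $A$ and $B$ annihilate. Moreover $C y = C C^+ T v = T v$ because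
  $\mathrm{im}\, T \subseteq \mathrm{im}\, C$, and therefore
  $S y = T v - T y = T (y + z) - T y = T z$.
\<close>

lemma parallel_sum_splitting:
  fixes A B :: "'a::linordered_field mat"
  assumes A: "A \<in> carrier_mat a n" and B: "B \<in> carrier_mat b n" and v: "v \<in> carrier_vec n"
  defines "S \<equiv> transpose_mat A * A" and "T \<equiv> transpose_mat B * B"
  defines "y \<equiv> moore_penrose (S + T) *\<^sub>v (T *\<^sub>v v)" and "z \<equiv> moore_penrose (S + T) *\<^sub>v (S *\<^sub>v v)"
  shows "y \<in> carrier_vec n" "z \<in> carrier_vec n"
    and "A *\<^sub>v (y + z) = A *\<^sub>v v" "B *\<^sub>v (y + z) = B *\<^sub>v v"
    and "S *\<^sub>v y = T *\<^sub>v z"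
proof -
  let ?C = "S + T" and ?P = "moore_penrose (S + T)"
  have S: "S \<in> carrier_mat n n" and T: "T \<in> carrier_mat n n"
    using A B by (auto simp: S_def T_def)
  have St: "transpose_mat S = S" and Tt: "transpose_mat T = T"
    by (simp_all add: S_def T_def transpose_gram[OF A] transpose_gram[OF B])
  have C: "?C \<in> carrier_mat n n" using S T by simp
  have Ct: "transpose_mat ?C = ?C" using S T St Tt by (simp add: transpose_add)
  note P = moore_penrose_symmetric[OF C Ct]
  have Cv: "?C *\<^sub>v x = S *\<^sub>v x + T *\<^sub>v x" if "x \<in> carrier_vec n" for x
    using S T that by (rule add_mult_distrib_mat_vec)
  show y: "y \<in> carrier_vec n" and z: "z \<in> carrier_vec n"
    using P(1) S T v by (auto simp: y_def z_def)
  have "z + y = ?P *\<^sub>v (?C *\<^sub>v v)"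
    unfolding y_def z_def Cv[OF v] using P(1) S T v
    by (intro mult_add_distrib_mat_vec[symmetric]) auto
  then have yz: "y + z = ?P *\<^sub>v (?C *\<^sub>v v)"
    using y z comm_add_vec[of y n z] by simp
  have "?C *\<^sub>v (y + z - v) = 0\<^sub>v n"
    using P(2)[OF v] mult_mat_vec_minus_eq_0_iff[OF C, of "y + z" v] y z v
    by (metis add_carrier_vec yz)
  then have 0: "A *\<^sub>v (y + z - v) = 0\<^sub>v a" "B *\<^sub>v (y + z - v) = 0\<^sub>v b"
    using gram_sum_kernel[OF A B, of "y + z - v"] y z v by (auto simp: S_def T_def)
  show Av: "A *\<^sub>v (y + z) = A *\<^sub>v v"
    using 0 y z v mult_mat_vec_minus_eq_0_iff[OF A, of "y + z" v] by simp
  show Bv: "B *\<^sub>v (y + z) = B *\<^sub>v v"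
    using 0 y z v mult_mat_vec_minus_eq_0_iff[OF B, of "y + z" v] by simp
  have Tyz: "T *\<^sub>v (y + z) = T *\<^sub>v v"
    using Bv B y z v by (simp add: T_def assoc_mult_mat_vec[of _ n b _ n])
  \<comment> \<open>\<open>C C\<^sup>+\<close> fixes \<open>T v\<close>: the error \<open>k\<close> lies in \<open>ker C\<close>, hence is orthogonal both to
    \<open>im C\<close> and to \<open>im T\<close>, hence to itself.\<close>
  have Cy: "?C *\<^sub>v y = T *\<^sub>v v"
  proof -
    define k where "k = T *\<^sub>v v - ?C *\<^sub>v y"
    have Tv: "T *\<^sub>v v \<in> carrier_vec n" and Cyc: "?C *\<^sub>v y \<in> carrier_vec n"
      using mult_mat_vec_carrier[OF T v] mult_mat_vec_carrier[OF C y] .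
    have k: "k \<in> carrier_vec n" using Tv Cyc by (simp add: k_def)
    have Ck: "?C *\<^sub>v k = 0\<^sub>v n"
      unfolding k_def mult_minus_distrib_mat_vec[OF C Tv Cyc]
      using P(3)[OF Tv] C Tv by (simp add: y_def)
    then have "B *\<^sub>v k = 0\<^sub>v b" using gram_sum_kernel[OF A B k] by (simp add: S_def T_def)
    then have Tk: "T *\<^sub>v k = 0\<^sub>v n"
    proof -
      have "T *\<^sub>v k = transpose_mat B *\<^sub>v (B *\<^sub>v k)"
        using B k by (simp add: T_def assoc_mult_mat_vec[of _ n b _ n])
      also have "\<dots> = 0\<^sub>v n" unfolding \<open>B *\<^sub>v k = 0\<^sub>v b\<close> using B by (intro eq_vecI) auto
      finally show ?thesis .
    qed
    have "k \<bullet> k = k \<bullet> (T *\<^sub>v v) - k \<bullet> (?C *\<^sub>v y)"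
      using scalar_prod_minus_distrib[OF k Tv Cyc] by (simp add: k_def)
    also have "k \<bullet> (T *\<^sub>v v) = 0"
      using transpose_vec_mult_scalar[OF T v k] Tk Tt v by simp
    also have "k \<bullet> (?C *\<^sub>v y) = 0"
      using transpose_vec_mult_scalar[OF C y k] Ck Ct y by simp
    finally have "k = 0\<^sub>v n" using scalar_prod_self_eq_0D k by auto
    then show ?thesis using vec_eq_if_minus_eq_0[OF _ Tv Cyc] by (simp add: k_def)
  qed
  have "S *\<^sub>v y + T *\<^sub>v y = T *\<^sub>v y + T *\<^sub>v z"
    using Cy Tyz Cv[OF y] mult_add_distrib_mat_vec[OF T y z] by simp
  moreover have "S *\<^sub>v y \<in> carrier_vec n" "T *\<^sub>v y \<in> carrier_vec n" "T *\<^sub>v z \<in> carrier_vec n"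
    using S T y z by auto
  ultimately show "S *\<^sub>v y = T *\<^sub>v z"
    by (rule vec_add_cancel_commuted)
qed

text \<open>
  In the expansion of $|A(y+z)|^2$ the cross term is
  $Ay \bullet Az = z \bullet A^T A y = z \bullet B^T B z = |Bz|^2$. The hypothesis is
  symmetric in $(A, y)$ and $(B, z)$, so the lemma gives the bound by $|B(y+z)|^2$ too.
\<close>

lemma split_sq_length_le:
  fixes A B :: "'a::linordered_field mat"
  assumes A: "A \<in> carrier_mat a n" and B: "B \<in> carrier_mat b n"
    and y: "y \<in> carrier_vec n" and z: "z \<in> carrier_vec n"
    and eq: "transpose_mat A * A *\<^sub>v y = transpose_mat B * B *\<^sub>v z"
  shows "(A *\<^sub>v y) \<bullet> (A *\<^sub>v y) + (B *\<^sub>v z) \<bullet> (B *\<^sub>v z) \<le> (A *\<^sub>v (y + z)) \<bullet> (A *\<^sub>v (y + z))"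
proof -
  have Ay: "A *\<^sub>v y \<in> carrier_vec a" and Az: "A *\<^sub>v z \<in> carrier_vec a" using A y z by auto
  have "(A *\<^sub>v y) \<bullet> (A *\<^sub>v z) = (transpose_mat A *\<^sub>v (A *\<^sub>v y)) \<bullet> z"
    using transpose_vec_mult_scalar[OF A z Ay] by simp
  also have "\<dots> = z \<bullet> (transpose_mat B * B *\<^sub>v z)"
    unfolding eq[symmetric] using A y z
    by (simp add: comm_scalar_prod[of _ n] assoc_mult_mat_vec[of _ n a _ n])
  also have "\<dots> = (B *\<^sub>v z) \<bullet> (B *\<^sub>v z)" by (rule quadratic_form_gram[OF B z])
  finally have cross: "(A *\<^sub>v y) \<bullet> (A *\<^sub>v z) = (B *\<^sub>v z) \<bullet> (B *\<^sub>v z)" .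
  have "(A *\<^sub>v (y + z)) \<bullet> (A *\<^sub>v (y + z)) =
      (A *\<^sub>v y) \<bullet> (A *\<^sub>v y) + 2 * ((A *\<^sub>v y) \<bullet> (A *\<^sub>v z)) + (A *\<^sub>v z) \<bullet> (A *\<^sub>v z)"
    unfolding mult_add_distrib_mat_vec[OF A y z] using Ay Az comm_scalar_prod[OF Az Ay]
    by (simp add: add_scalar_prod_distrib[of _ a] scalar_prod_add_distrib[of _ a])
  then show ?thesis
    using cross scalar_prod_self_nonneg[of "A *\<^sub>v z"] scalar_prod_self_nonneg[of "B *\<^sub>v z"] by linarith
qed

text \<open>
  The bound by $|Ax|^2$ forces $D$ to vanish wherever $A$ does, so $Dv = Dy + Dz$, although
  $v = y + z$ is only known up to $\ker A$. The factor $2$ comes from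
  $|p + q|^2 \le 2|p|^2 + 2|q|^2$.
\<close>

lemma sq_length_le_if_splitting:
  fixes A B D :: "'a::linordered_field mat"
  assumes D: "D \<in> carrier_mat d n" and A: "A \<in> carrier_mat a n" and B: "B \<in> carrier_mat b n"
    and r: "\<And>x. x \<in> carrier_vec n \<Longrightarrow> (D *\<^sub>v x) \<bullet> (D *\<^sub>v x) \<le> of_nat r * ((A *\<^sub>v x) \<bullet> (A *\<^sub>v x))"
    and s: "\<And>x. x \<in> carrier_vec n \<Longrightarrow> (D *\<^sub>v x) \<bullet> (D *\<^sub>v x) \<le> of_nat s * ((B *\<^sub>v x) \<bullet> (B *\<^sub>v x))"
    and v: "v \<in> carrier_vec n" and y: "y \<in> carrier_vec n" and z: "z \<in> carrier_vec n"
    and Av: "A *\<^sub>v (y + z) = A *\<^sub>v v"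
  shows "(D *\<^sub>v v) \<bullet> (D *\<^sub>v v) \<le>
    of_nat (2 * (r + s)) * ((A *\<^sub>v y) \<bullet> (A *\<^sub>v y) + (B *\<^sub>v z) \<bullet> (B *\<^sub>v z))"
proof -
  have Dy: "D *\<^sub>v y \<in> carrier_vec d" and Dz: "D *\<^sub>v z \<in> carrier_vec d" using D y z by auto
  have "A *\<^sub>v (y + z - v) = 0\<^sub>v a"
    using y z v Av mult_mat_vec_minus_eq_0_iff[OF A, of "y + z" v] by simp
  then have "(D *\<^sub>v (y + z - v)) \<bullet> (D *\<^sub>v (y + z - v)) \<le> 0"
    using r[of "y + z - v"] y z v by simp
  then have "D *\<^sub>v (y + z - v) = 0\<^sub>v d"
    using scalar_prod_self_nonneg[of "D *\<^sub>v (y + z - v)"] D y z v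
    by (intro scalar_prod_self_eq_0D) auto
  then have "D *\<^sub>v (y + z) = D *\<^sub>v v"
    using y z v mult_mat_vec_minus_eq_0_iff[OF D, of "y + z" v] by simp
  then have Dv: "D *\<^sub>v v = D *\<^sub>v y + D *\<^sub>v z"
    using mult_add_distrib_mat_vec[OF D y z] by simp
  have "(D *\<^sub>v v) \<bullet> (D *\<^sub>v v) \<le> 2 * ((D *\<^sub>v y) \<bullet> (D *\<^sub>v y)) + 2 * ((D *\<^sub>v z) \<bullet> (D *\<^sub>v z))"
    unfolding Dv by (rule scalar_prod_sq_add_le[OF Dy Dz])
  also have "\<dots> \<le> 2 * (of_nat r * ((A *\<^sub>v y) \<bullet> (A *\<^sub>v y))) + 2 * (of_nat s * ((B *\<^sub>v z) \<bullet> (B *\<^sub>v z)))"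
    using r[OF y] s[OF z] by simp
  also have "\<dots> \<le> 2 * (of_nat (r + s) * ((A *\<^sub>v y) \<bullet> (A *\<^sub>v y))) + 2 * (of_nat (r + s) * ((B *\<^sub>v z) \<bullet> (B *\<^sub>v z)))"
    by (intro add_mono mult_left_mono mult_right_mono scalar_prod_self_nonneg) auto
  also have "\<dots> = of_nat (2 * (r + s)) * ((A *\<^sub>v y) \<bullet> (A *\<^sub>v y) + (B *\<^sub>v z) \<bullet> (B *\<^sub>v z))"
    by (simp add: algebra_simps)
  finally show ?thesis .
qed

section \<open>Meet and join\<close>

lemma is_glb_append_rows:
  fixes A B :: "'a::linordered_field mat"
  assumes A: "A \<in> matrices_with_cols n" and B: "B \<in> matrices_with_cols n"
  shows "is_glb (val_poset n) (val_class n (A @\<^sub>r B)) {val_class n A, val_class n B}"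
proof (rule is_glb_val_classI[OF A B append_rows_matrices_with_cols[OF A B]])
  obtain a b where ab: "A \<in> carrier_mat a n" "B \<in> carrier_mat b n"
    using A B by (auto simp: matrices_with_cols_def)
  note M = append_rows_matrices_with_cols[OF A B]
  note sq = append_rows_sq_length[OF ab]
  show "dominates n A (A @\<^sub>r B)"
    unfolding dominates_iff_sq_length[OF A M]
    by (intro exI[of _ 1]) (simp add: sq scalar_prod_self_nonneg)
  show "dominates n B (A @\<^sub>r B)"
    unfolding dominates_iff_sq_length[OF B M]
    by (intro exI[of _ 1]) (simp add: sq scalar_prod_self_nonneg)
  fix D :: "'a mat"
  assume D: "D \<in> matrices_with_cols n" and "dominates n A D" "dominates n B D"
  then obtain r s :: nat where
    r: "\<And>v. v \<in> carrier_vec n \<Longrightarrow> (A *\<^sub>v v) \<bullet> (A *\<^sub>v v) \<le> of_nat r * ((D *\<^sub>v v) \<bullet> (D *\<^sub>v v))" and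
    s: "\<And>v. v \<in> carrier_vec n \<Longrightarrow> (B *\<^sub>v v) \<bullet> (B *\<^sub>v v) \<le> of_nat s * ((D *\<^sub>v v) \<bullet> (D *\<^sub>v v))"
    unfolding dominates_iff_sq_length[OF A D] dominates_iff_sq_length[OF B D] by blast
  show "dominates n (A @\<^sub>r B) D"
    unfolding dominates_iff_sq_length[OF M D]
    by (intro exI[of _ "r + s"] ballI) (use r s in \<open>simp add: sq distrib_right add_mono\<close>)
qed

lemma is_lub_parallel_sum:
  fixes A B :: "'a::linordered_field mat"
  assumes A: "A \<in> matrices_with_cols n" and B: "B \<in> matrices_with_cols n"
  defines "S \<equiv> transpose_mat A * A" and "T \<equiv> transpose_mat B * B"
  shows "is_lub (val_poset n)
           (val_class n ((A * moore_penrose (S + T) * T) @\<^sub>r (B * moore_penrose (S + T) * S)))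
           {val_class n A, val_class n B}"
proof -
  obtain a b where ab: "A \<in> carrier_mat a n" "B \<in> carrier_mat b n" "a \<ge> 1" "b \<ge> 1"
    using A B by (auto simp: matrices_with_cols_def)
  let ?P = "moore_penrose (S + T)"
  let ?U = "A * ?P * T" and ?V = "B * ?P * S"
  let ?y = "\<lambda>v. ?P *\<^sub>v (T *\<^sub>v v)" and ?z = "\<lambda>v. ?P *\<^sub>v (S *\<^sub>v v)"
  have S: "S \<in> carrier_mat n n" and T: "T \<in> carrier_mat n n"
    using ab by (auto simp: S_def T_def)
  have sym: "transpose_mat (S + T) = S + T"
    using transpose_add[OF S T] transpose_gram[OF ab(1)] transpose_gram[OF ab(2)]
    by (simp add: S_def T_def)
  have P: "?P \<in> carrier_mat n n"
    using moore_penrose_symmetric(1)[OF _ sym] S T by simp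
  have U: "?U \<in> carrier_mat a n" and V: "?V \<in> carrier_mat b n" using ab P S T by auto
  have M: "?U @\<^sub>r ?V \<in> matrices_with_cols n"
    using U V ab(3,4) by (intro append_rows_matrices_with_cols) (auto simp: matrices_with_cols_def)
  have sq: "((?U @\<^sub>r ?V) *\<^sub>v v) \<bullet> ((?U @\<^sub>r ?V) *\<^sub>v v) =
      (A *\<^sub>v ?y v) \<bullet> (A *\<^sub>v ?y v) + (B *\<^sub>v ?z v) \<bullet> (B *\<^sub>v ?z v)" if v: "v \<in> carrier_vec n" for v
  proof -
    have "?U *\<^sub>v v = A *\<^sub>v ?y v"
      using ab P T v by (simp add: assoc_mult_mat_vec[of _ a n _ n] assoc_mult_mat_vec[of _ n n _ n])
    moreover have "?V *\<^sub>v v = B *\<^sub>v ?z v"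
      using ab P S v by (simp add: assoc_mult_mat_vec[of _ b n _ n] assoc_mult_mat_vec[of _ n n _ n])
    ultimately show ?thesis using append_rows_sq_length[OF U V v] by simp
  qed
  note split = parallel_sum_splitting[OF ab(1,2), folded S_def T_def]
  show ?thesis
  proof (rule is_lub_val_classI[OF A B M])
    have "((?U @\<^sub>r ?V) *\<^sub>v v) \<bullet> ((?U @\<^sub>r ?V) *\<^sub>v v) \<le> (A *\<^sub>v v) \<bullet> (A *\<^sub>v v)"
      if v: "v \<in> carrier_vec n" for v
      using split_sq_length_le[OF ab(1,2) split(1,2)[OF v], folded S_def T_def]
        split(3,5)[OF v] sq[OF v] by simp
    then show "dominates n (?U @\<^sub>r ?V) A"
      unfolding dominates_iff_sq_length[OF M A] by (intro exI[of _ 1]) simp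
    have "((?U @\<^sub>r ?V) *\<^sub>v v) \<bullet> ((?U @\<^sub>r ?V) *\<^sub>v v) \<le> (B *\<^sub>v v) \<bullet> (B *\<^sub>v v)"
      if v: "v \<in> carrier_vec n" for v
      using split_sq_length_le[OF ab(2,1) split(2,1)[OF v], folded S_def T_def]
        split(4,5)[OF v] sq[OF v] comm_add_vec[OF split(1,2)[OF v]] by (simp add: add.commute)
    then show "dominates n (?U @\<^sub>r ?V) B"
      unfolding dominates_iff_sq_length[OF M B] by (intro exI[of _ 1]) simp
    fix D :: "'a mat"
    assume D: "D \<in> matrices_with_cols n" and "dominates n D A" "dominates n D B"
    then obtain r s :: nat where
      r: "\<And>v. v \<in> carrier_vec n \<Longrightarrow> (D *\<^sub>v v) \<bullet> (D *\<^sub>v v) \<le> of_nat r * ((A *\<^sub>v v) \<bullet> (A *\<^sub>v v))" and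
      s: "\<And>v. v \<in> carrier_vec n \<Longrightarrow> (D *\<^sub>v v) \<bullet> (D *\<^sub>v v) \<le> of_nat s * ((B *\<^sub>v v) \<bullet> (B *\<^sub>v v))"
      unfolding dominates_iff_sq_length[OF D A] dominates_iff_sq_length[OF D B] by blast
    obtain d where d: "D \<in> carrier_mat d n" using D by (auto simp: matrices_with_cols_def)
    show "dominates n D (?U @\<^sub>r ?V)"
      unfolding dominates_iff_sq_length[OF D M]
    proof (intro exI[of _ "2 * (r + s)"] ballI)
      fix v :: "'a vec" assume v: "v \<in> carrier_vec n"
      show "(D *\<^sub>v v) \<bullet> (D *\<^sub>v v) \<le>
          of_nat (2 * (r + s)) * (((?U @\<^sub>r ?V) *\<^sub>v v) \<bullet> ((?U @\<^sub>r ?V) *\<^sub>v v))"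
        unfolding sq[OF v]
        by (rule sq_length_le_if_splitting[OF d ab(1,2) r s v split(1-3)[OF v]]) (use v in auto)
    qed
  qed
qed

theorem proposition4p4:
  fixes A B :: "'a::linordered_field mat" and n :: nat
  assumes "n \<ge> 1"
    and "A \<in> matrices_with_cols n" and "B \<in> matrices_with_cols n"
  shows "is_glb (val_poset n) (val_class n (A @\<^sub>r B)) {val_class n A, val_class n B} \<and>
         is_lub (val_poset n)
           (val_class n
              ((A * moore_penrose (transpose_mat A * A + transpose_mat B * B) * (transpose_mat B * B))
               @\<^sub>r
               (B * moore_penrose (transpose_mat A * A + transpose_mat B * B) * (transpose_mat A * A))))
           {val_class n A, val_class n B}"
  using is_glb_append_rows[OF assms(2,3)] is_lub_parallel_sum[OF assms(2,3)] by blast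

end
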